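(* Let $\delta\in\{\mathrm{I},\mathrm{D},\mathrm{U},\mathrm{X}\}^n$. The map sending a $\delta$-permutree $T$ on $n$ nodes to its cubic vector $\vec c(T)\in\mathbb{Z}^{n-1}$ is injective.
   Context: Decorations: $\mathrm{I}$ (one parent, one child), $\mathrm{D}$ (one parent, two children), $\mathrm{U}$ (two parents, one child), $\mathrm{X}$ (two parents, two children). A $\delta$-permutree is a directed tree on nodes $v_1,\dots,v_n$ (with dangling leaf/root edges allowed, so a neighbour slot may be empty) in which $v_i$ has two parent slots if $\delta_i\in\{\mathrm{U},\mathrm{X}\}$ and one otherwise, and two child slots if $\delta_i\in\{\mathrm{D},\mathrm{X}\}$ and one otherwise. Removing $v_i$, each slot determines a (possibly empty) subtree, consisting of the nodes in the connected component reached through that slot; when there are two child slots the left descendant subtree $LD_i$ has all labels $<i$ and the right descendant subtree $RD_i$ all labels $>i$ (similarly for two parents). If $v_i$ has one child slot, $D_i$ denotes its descendant subtree. The cubic set of $T$ is $C(T):=\{(i,j): i<j \text{ and } v_j\in D_i\}$ for those $i$ with $\delta_i\in\{\mathrm{I},\mathrm{U}\}$, together with $\{(i,j): v_j\in RD_i\}$ for those $i$ with $\delta_i\in\{\mathrm{D},\mathrm{X}\}$. The cubic vector is $\vec c(T)=(c_1,\dots,c_{n-1})$ with $c_i=|\{j:(i,j)\in C(T)\}|$. *)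

theory Defs
  imports Main
begin

datatype decoration = DecI | DecD | DecU | DecX

text \<open>Decorations are indexed from 1, as are the nodes \<open>v\<^sub>1, \<dots>, v\<^sub>n\<close>;
  node \<open>v\<^sub>i\<close> is represented by its label \<open>i\<close>.\<close>

definition dec :: "decoration list \<Rightarrow> nat \<Rightarrow> decoration" where
  "dec \<delta> i = \<delta> ! (i - 1)"

datatype slot = Only | Left | Right

definition child_slots :: "decoration \<Rightarrow> slot set" where
  "child_slots d = (if d \<in> {DecD, DecX} then {Left, Right} else {Only})"

definition parent_slots :: "decoration \<Rightarrow> slot set" where
  "parent_slots d = (if d \<in> {DecU, DecX} then {Left, Right} else {Only})"

text \<open>An edge joins a parent slot of the node \<open>child\<close> to a child slot of the node
  \<open>parent\<close>. A labelled tree is given by its set of edges between nodes; the dangling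
  leaf and root edges are the slots that no element of this set uses.\<close>

datatype edge = Edge (child: nat) (pslot: slot) (parent: nat) (cslot: slot)

definition ends :: "edge \<Rightarrow> nat set" where
  "ends e = {child e, parent e}"

definition adj :: "edge set \<Rightarrow> (nat \<times> nat) set" where
  "adj T = {(u, v). \<exists>e\<in>T. ends e = {u, v}}"

text \<open>Cycles of the underlying undirected multigraph. Loops are cycles of length 1, and two
  distinct edges with the same ends form a cycle of length 2.\<close>

definition is_cycle :: "edge set \<Rightarrow> nat list \<Rightarrow> edge list \<Rightarrow> bool" where
  "is_cycle T vs es \<longleftrightarrow>
     es \<noteq> [] \<and> length vs = length es \<and> distinct vs \<and> distinct es \<and> set es \<subseteq> T \<and>
     (\<forall>k<length es. ends (es ! k) = {vs ! k, vs ! (Suc k mod length es)})"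

definition is_tree :: "nat set \<Rightarrow> edge set \<Rightarrow> bool" where
  "is_tree V T \<longleftrightarrow>
     V \<noteq> {} \<and> (\<forall>e\<in>T. ends e \<subseteq> V) \<and>
     (\<forall>u\<in>V. \<forall>v\<in>V. (u, v) \<in> (adj T)\<^sup>*) \<and>
     (\<nexists>vs es. is_cycle T vs es)"

definition component_without :: "edge set \<Rightarrow> nat \<Rightarrow> nat \<Rightarrow> nat set" where
  "component_without T i u = {w. (u, w) \<in> (adj {e \<in> T. i \<notin> ends e})\<^sup>*}"

text \<open>With \<open>s = Only, Left, Right\<close>, the following are the subtrees
  \<open>D\<^sub>i\<close>, \<open>LD\<^sub>i\<close>, \<open>RD\<^sub>i\<close> and
  their ancestor counterparts; they are empty if the slot is unused.\<close>

definition desc :: "edge set \<Rightarrow> nat \<Rightarrow> slot \<Rightarrow> nat set" where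
  "desc T i s = (\<Union>e\<in>{e \<in> T. parent e = i \<and> cslot e = s}. component_without T i (child e))"

definition anc :: "edge set \<Rightarrow> nat \<Rightarrow> slot \<Rightarrow> nat set" where
  "anc T i s = (\<Union>e\<in>{e \<in> T. child e = i \<and> pslot e = s}. component_without T i (parent e))"

definition permutree :: "decoration list \<Rightarrow> edge set \<Rightarrow> bool" where
  "permutree \<delta> T \<longleftrightarrow>
     is_tree {1..length \<delta>} T \<and>
     (\<forall>e\<in>T. pslot e \<in> parent_slots (dec \<delta> (child e)) \<and>
             cslot e \<in> child_slots (dec \<delta> (parent e))) \<and>
     (\<forall>e\<in>T. \<forall>e'\<in>T. child e = child e' \<and> pslot e = pslot e' \<longrightarrow> e = e') \<and>
     (\<forall>e\<in>T. \<forall>e'\<in>T. parent e = parent e' \<and> cslot e = cslot e' \<longrightarrow> e = e') \<and>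
     (\<forall>i\<in>{1..length \<delta>}. dec \<delta> i \<in> {DecD, DecX} \<longrightarrow>
        (\<forall>j\<in>desc T i Left. j < i) \<and> (\<forall>j\<in>desc T i Right. i < j)) \<and>
     (\<forall>i\<in>{1..length \<delta>}. dec \<delta> i \<in> {DecU, DecX} \<longrightarrow>
        (\<forall>j\<in>anc T i Left. j < i) \<and> (\<forall>j\<in>anc T i Right. i < j))"

definition cubic_set :: "decoration list \<Rightarrow> edge set \<Rightarrow> (nat \<times> nat) set" where
  "cubic_set \<delta> T =
     {(i, j). i \<in> {1..length \<delta>} \<and> dec \<delta> i \<in> {DecI, DecU} \<and> i < j \<and> j \<in> desc T i Only} \<union>
     {(i, j). i \<in> {1..length \<delta>} \<and> dec \<delta> i \<in> {DecD, DecX} \<and> j \<in> desc T i Right}"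

text \<open>A vector in \<open>\<int>\<^bsup>n-1\<^esup>\<close> is a list of \<open>n - 1\<close> integers;
  \<open>[1..<n]\<close> lists \<open>1, \<dots>, n - 1\<close>.\<close>

definition cubic_vector :: "decoration list \<Rightarrow> edge set \<Rightarrow> int list" where
  "cubic_vector \<delta> T = map (\<lambda>i. int (card {j. (i, j) \<in> cubic_set \<delta> T})) [1..<length \<delta>]"

lemma length_cubic_vector: "length (cubic_vector \<delta> T) = length \<delta> - 1"
  by (simp add: cubic_vector_def)

end

theory Submission
  imports Defs
begin

text \<open>Record a permutree by the relation ``\<open>j\<close> is reached from \<open>i\<close> through a child slot''.
  Because of the label conditions, this relation and the decorations determine the slot of \<open>i\<close>
  through which \<open>j\<close> is reached, hence which nodes separate which, hence the edges. It remains to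
  recover the relation from the cubic vector. This is done on the label sets \<open>{m..n}\<close> for
  decreasing \<open>m\<close>: the nodes above \<open>m\<close> being settled, the sets \<open>S\<close>, \<open>S'\<close> of nodes below \<open>m\<close> in two
  candidates are comparable, for if \<open>b \<in> S' - S\<close> and \<open>a\<close> is the least element of \<open>S - S'\<close>, then
  the point where the path from \<open>m\<close> to \<open>a\<close> in one of the trees changes direction is a smaller
  element of \<open>S - S'\<close>. As the cubic vector gives \<open>card S = card S'\<close>, the two sets agree.\<close>

section \<open>Paths and bridges\<close>

inductive simple_path :: "edge set \<Rightarrow> nat list \<Rightarrow> edge list \<Rightarrow> bool" for S where
  single: "simple_path S [y] []"
| step: "simple_path S (z # vs) es \<Longrightarrow> x \<notin> set (z # vs) \<Longrightarrow> e \<in> S \<Longrightarrow> ends e = {x, z} \<Longrightarrow>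
    simple_path S (x # z # vs) (e # es)"

lemma simple_path_facts:
  assumes "simple_path S vs es"
  shows "length vs = Suc (length es)" "distinct vs" "set es \<subseteq> S"
    "k < length es \<Longrightarrow> ends (es ! k) = {vs ! k, vs ! Suc k}"
  using assms by (induction arbitrary: k) (auto simp: nth_Cons split: nat.split)

text \<open>If positions \<open>k < l\<close> carried the same edge, the node \<open>vs ! k\<close>
  would recur at position \<open>l\<close> or \<open>Suc l\<close> of \<open>vs\<close>.\<close>

lemma simple_path_distinct_edges:
  assumes "simple_path S vs es"
  shows "distinct es"
proof -
  note f = simple_path_facts[OF assms]
  have "es ! k \<noteq> es ! l" if "k < l" "l < length es" for k l
  proof
    assume "es ! k = es ! l"
    then have "{vs ! k, vs ! Suc k} = {vs ! l, vs ! Suc l}"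
      using f(4) that by (metis order.strict_trans)
    then have "vs ! k = vs ! l \<or> vs ! k = vs ! Suc l" by blast
    then show False
      using that f(1,2) by (auto simp: nth_eq_iff_index_eq)
  qed
  then show ?thesis
    by (metis distinct_conv_nth linorder_neqE_nat)
qed

text \<open>Used to cut out a loop: when a walk returns to \<open>x\<close>, only the part starting
  at \<open>x\<close> is kept.\<close>

lemma simple_path_suffix:
  assumes "simple_path S vs es" "x \<in> set vs"
  shows "\<exists>vs' es'. simple_path S (x # vs') es' \<and> last (x # vs') = last vs"
  using assms
proof (induction)
  case (single y)
  then show ?case by (auto intro: simple_path.single)
next
  case (step z vs es u e)
  show ?case
  proof (cases "x = u")
    case True
    then show ?thesis using simple_path.step[OF step.hyps] by blast
  next
    case False
    then show ?thesis using step by auto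
  qed
qed

lemma rtrancl_adj_simple_path:
  assumes "(x, y) \<in> (adj S)\<^sup>*"
  shows "\<exists>vs es. simple_path S (x # vs) es \<and> last (x # vs) = y"
  using assms
proof (induction rule: converse_rtrancl_induct)
  case base
  then show ?case by (metis simple_path.single last.simps)
next
  case (step x z)
  then obtain vs es where p: "simple_path S (z # vs) es" "last (z # vs) = y" by blast
  obtain e where e: "e \<in> S" "ends e = {x, z}" using step.hyps(1) by (auto simp: adj_def)
  show ?case
  proof (cases "x \<in> set (z # vs)")
    case True
    then show ?thesis using simple_path_suffix[OF p(1)] p(2) by metis
  next
    case False
    then show ?thesis
      using simple_path.step[OF p(1) _ e] p(2) by (metis last_ConsR list.distinct(1))
  qed
qed

lemma sym_adj: "sym (adj T)"
  by (auto simp: adj_def sym_def insert_commute)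

lemma adj_rtrancl_sym: "(x, y) \<in> (adj T)\<^sup>* \<Longrightarrow> (y, x) \<in> (adj T)\<^sup>*"
  using sym_adj sym_rtrancl by (metis symD)

lemma adj_rtrancl_mono: "(x, y) \<in> (adj S)\<^sup>* \<Longrightarrow> S \<subseteq> T \<Longrightarrow> (x, y) \<in> (adj T)\<^sup>*"
  by (erule rtrancl_mono[THEN subsetD, rotated]) (auto simp: adj_def)

lemma adjI: "e \<in> T \<Longrightarrow> ends e = {x, y} \<Longrightarrow> (x, y) \<in> adj T"
  by (auto simp: adj_def)

section \<open>Directions: the edge at a node that leads to a given other node\<close>

definition avoiding :: "edge set \<Rightarrow> nat \<Rightarrow> (nat \<times> nat) set" where
  "avoiding T i = (adj {e \<in> T. i \<notin> ends e})\<^sup>*"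

lemma component_without_eq: "component_without T i u = {w. (u, w) \<in> avoiding T i}"
  by (simp add: component_without_def avoiding_def)

lemma avoiding_sym: "(x, y) \<in> avoiding T i \<Longrightarrow> (y, x) \<in> avoiding T i"
  unfolding avoiding_def by (rule adj_rtrancl_sym)

lemma avoiding_remove_edge:
  "(x, y) \<in> avoiding T i \<Longrightarrow> i \<in> ends e \<Longrightarrow> (x, y) \<in> (adj (T - {e}))\<^sup>*"
  unfolding avoiding_def by (erule adj_rtrancl_mono) auto

lemma avoiding_ne: "(x, y) \<in> avoiding T i \<Longrightarrow> x \<noteq> i \<Longrightarrow> y \<noteq> i"
  unfolding avoiding_def by (induction rule: rtrancl_induct) (auto simp: adj_def)

text \<open>The other end of \<open>e\<close> as seen from \<open>i\<close>; it has this meaning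
  only when \<open>i\<close> is an end of \<open>e\<close>.\<close>

definition far :: "nat \<Rightarrow> edge \<Rightarrow> nat" where
  "far i e = (if parent e = i then child e else parent e)"

definition leads :: "edge set \<Rightarrow> nat \<Rightarrow> edge \<Rightarrow> nat \<Rightarrow> bool" where
  "leads T i e j \<longleftrightarrow> e \<in> T \<and> i \<in> ends e \<and> (far i e, j) \<in> avoiding T i"

text \<open>\<open>towards T i j\<close> and \<open>below T i j\<close> are junk when \<open>i = j\<close>: no edge leads from a node to itself.\<close>

definition towards :: "edge set \<Rightarrow> nat \<Rightarrow> nat \<Rightarrow> edge" where
  "towards T i j = (THE e. leads T i e j)"

definition below :: "edge set \<Rightarrow> nat \<Rightarrow> nat \<Rightarrow> bool" where
  "below T i j \<longleftrightarrow> parent (towards T i j) = i"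

lemma ends_far: "i \<in> ends e \<Longrightarrow> ends e = {i, far i e}"
  by (auto simp: ends_def far_def)

lemma leads_avoiding: "leads T i e j \<Longrightarrow> (j, k) \<in> avoiding T i \<Longrightarrow> leads T i e k"
  by (auto simp: leads_def avoiding_def)

lemma leads_far: "e \<in> T \<Longrightarrow> i \<in> ends e \<Longrightarrow> leads T i e (far i e)"
  by (simp add: leads_def avoiding_def)

locale labelled_tree =
  fixes V :: "nat set" and T :: "edge set"
  assumes tree: "is_tree V T" and finite_V: "finite V"
begin

text \<open>A simple path from \<open>x\<close> to \<open>y\<close> without \<open>e\<close> would
  be closed to a cycle by \<open>e\<close>. For \<open>x = y\<close> that cycle is a loop, so loops
  are excluded as well.\<close>

lemma bridge:
  assumes "e \<in> T" "ends e = {x, y}"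
  shows "(x, y) \<notin> (adj (T - {e}))\<^sup>*"
proof
  assume "(x, y) \<in> (adj (T - {e}))\<^sup>*"
  then obtain vs es where p: "simple_path (T - {e}) (x # vs) es" and l: "last (x # vs) = y"
    using rtrancl_adj_simple_path by blast
  note f = simple_path_facts[OF p]
  have y: "(x # vs) ! length es = y"
    using l f(1) by (metis diff_Suc_1 last_conv_nth list.distinct(1))
  have "is_cycle T (x # vs) (es @ [e])"
    unfolding is_cycle_def
  proof (intro conjI allI impI)
    show "distinct (es @ [e])" using simple_path_distinct_edges[OF p] f(3) by auto
    show "set (es @ [e]) \<subseteq> T" using f(3) assms by auto
    fix k assume "k < length (es @ [e])"
    then consider "k < length es" | "k = length es" by fastforce
    then show "ends ((es @ [e]) ! k) = {(x # vs) ! k, (x # vs) ! (Suc k mod length (es @ [e]))}"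
    proof cases
      case 1
      then show ?thesis using f(4)[of k] by (simp add: nth_append)
    next
      case 2
      then show ?thesis using y assms(2) by (simp add: insert_commute)
    qed
  qed (use f in auto)
  then show False using tree by (auto simp: is_tree_def)
qed

lemma ends_subset: "e \<in> T \<Longrightarrow> ends e \<subseteq> V"
  using tree by (auto simp: is_tree_def)

lemma no_loop: "e \<in> T \<Longrightarrow> child e \<noteq> parent e"
  using bridge[of e "child e" "parent e"] by (auto simp: ends_def)

lemma far_ne: "e \<in> T \<Longrightarrow> far i e \<noteq> i"
  using no_loop by (auto simp: far_def)

lemma far_far: "e \<in> T \<Longrightarrow> i \<in> ends e \<Longrightarrow> far (far i e) e = i"
  using no_loop by (auto simp: far_def ends_def)

lemma far_in: "e \<in> T \<Longrightarrow> i \<in> ends e \<Longrightarrow> far i e \<in> V"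
  using ends_subset by (auto simp: far_def ends_def)

text \<open>Otherwise \<open>i\<close> could be joined to \<open>far i e\<close> by leaving through
  \<open>e'\<close> and passing \<open>j\<close>, although \<open>e\<close> is a bridge.\<close>

lemma leads_unique:
  assumes "leads T i e j" "leads T i e' j"
  shows "e = e'"
proof (rule ccontr)
  assume ne: "e \<noteq> e'"
  have e: "e \<in> T" "i \<in> ends e" and e': "e' \<in> T" "i \<in> ends e'"
    and p: "(far i e, j) \<in> avoiding T i" "(far i e', j) \<in> avoiding T i"
    using assms by (auto simp: leads_def)
  have "(i, far i e') \<in> adj (T - {e})"
    using e' ne by (intro adjI[of e'] ends_far) auto
  moreover have "(far i e', j) \<in> (adj (T - {e}))\<^sup>*" "(j, far i e) \<in> (adj (T - {e}))\<^sup>*"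
    using p e by (auto intro: avoiding_remove_edge avoiding_sym)
  ultimately have "(i, far i e) \<in> (adj (T - {e}))\<^sup>*"
    by (meson converse_rtrancl_into_rtrancl rtrancl_trans)
  then show False using bridge[OF e(1) ends_far[OF e(2)]] by simp
qed

lemma leads_ne: "leads T i e j \<Longrightarrow> j \<noteq> i"
  using avoiding_ne[of "far i e" j T i] far_ne[of e i] by (auto simp: leads_def)

lemma leads_in:
  assumes "leads T i e j"
  shows "j \<in> V"
proof -
  have "(far i e, j) \<in> avoiding T i" using assms by (auto simp: leads_def)
  then show ?thesis
    unfolding avoiding_def
  proof (induction rule: rtrancl_induct)
    case base
    then show ?case using assms far_in by (auto simp: leads_def)
  next
    case (step y z)
    then obtain f where "f \<in> T" "ends f = {y, z}" by (auto simp: adj_def)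
    then show ?case using ends_subset[of f] by blast
  qed
qed

lemma leads_exists:
  assumes "i \<in> V" "j \<in> V" "i \<noteq> j"
  shows "\<exists>e. leads T i e j"
proof -
  have "(i, j) \<in> (adj T)\<^sup>*" using tree assms by (auto simp: is_tree_def)
  \<comment> \<open>The disjunct \<open>j = i\<close> covers walks that come back to
    \<open>i\<close>; the edge sought is the one taken at the last departure.\<close>
  then have "j = i \<or> (\<exists>e. leads T i e j)"
  proof (induction rule: rtrancl_induct)
    case (step y z)
    then obtain e where e: "e \<in> T" "ends e = {y, z}" by (auto simp: adj_def)
    consider "z = i" | "y = i" "z \<noteq> i" | "y \<noteq> i" "z \<noteq> i" by blast
    then show ?case
    proof cases
      case 2
      then have "far i e = z" "i \<in> ends e" using e by (auto simp: far_def ends_def doubleton_eq_iff)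
      then show ?thesis using leads_far[OF e(1)] by metis
    next
      case 3
      then have "(y, z) \<in> avoiding T i"
        unfolding avoiding_def using e by (intro r_into_rtrancl adjI[of e]) auto
      then show ?thesis using step.IH 3 leads_avoiding by blast
    qed simp
  qed simp
  then show ?thesis using assms by blast
qed

lemma leads_towards: "i \<in> V \<Longrightarrow> j \<in> V \<Longrightarrow> i \<noteq> j \<Longrightarrow> leads T i (towards T i j) j"
  unfolding towards_def using leads_exists leads_unique by (metis theI)

lemma towards_eq: "leads T i e j \<Longrightarrow> towards T i j = e"
  unfolding towards_def using leads_unique by blast

lemma towards_in:
  assumes "i \<in> V" "j \<in> V" "i \<noteq> j"
  shows "towards T i j \<in> T" "i \<in> ends (towards T i j)"
  using leads_towards[OF assms] by (auto simp: leads_def)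

text \<open>The walk from \<open>i\<close> through \<open>e\<close> stays in the branch behind
  \<open>e\<close>, to which \<open>a\<close> does not belong. The induction therefore carries
  membership in that branch along.\<close>

lemma leads_reach_avoiding:
  assumes "leads T i e j" "a \<noteq> i" "\<not> leads T i e a"
  shows "(i, j) \<in> avoiding T a"
proof -
  have e: "e \<in> T" "i \<in> ends e" and p: "(far i e, j) \<in> avoiding T i"
    using assms(1) by (auto simp: leads_def)
  have "(i, j) \<in> avoiding T a \<and> leads T i e j"
    using p unfolding avoiding_def[of T i]
  proof (induction rule: rtrancl_induct)
    case base
    have "leads T i e (far i e)" using leads_far e by simp
    then have "a \<notin> ends e" using assms(2,3) ends_far[OF e(2)] by auto
    then have "(i, far i e) \<in> avoiding T a"
      unfolding avoiding_def using e ends_far by (intro r_into_rtrancl adjI[of e]) auto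
    with \<open>leads T i e (far i e)\<close> show ?case by simp
  next
    case (step y z)
    then obtain f where f: "f \<in> T" "i \<notin> ends f" "ends f = {y, z}" by (auto simp: adj_def)
    have "(y, z) \<in> avoiding T i"
      using step.hyps(2) by (auto simp: avoiding_def)
    then have "leads T i e z"
      using step.IH leads_avoiding by blast
    then have "a \<notin> ends f" using f step.IH assms(3) by auto
    then have "(y, z) \<in> avoiding T a"
      unfolding avoiding_def using f by (intro r_into_rtrancl adjI[of f]) auto
    then show ?case using step.IH \<open>leads T i e z\<close> by (auto simp: avoiding_def)
  qed
  then show ?thesis ..
qed

text \<open>Here \<open>b\<close> lies between \<open>a\<close> and \<open>c\<close>: the branch at
  \<open>b\<close> containing \<open>c\<close> does not contain \<open>a\<close>, so
  \<open>b\<close> and \<open>c\<close> are joined without meeting \<open>a\<close>.\<close>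

lemma separated_same_direction:
  assumes "a \<in> V" "b \<in> V" "c \<in> V" "a \<noteq> b" "b \<noteq> c" "towards T b a \<noteq> towards T b c"
  shows "towards T a c = towards T a b"
proof -
  have "\<not> leads T b (towards T b c) a" using assms(6) towards_eq by blast
  then have "(b, c) \<in> avoiding T a"
    using leads_reach_avoiding leads_towards[of b c] assms by metis
  then show ?thesis
    using leads_avoiding leads_towards[of a b] towards_eq assms by metis
qed

lemma towards_edge: "e \<in> T \<Longrightarrow> i \<in> ends e \<Longrightarrow> towards T i (far i e) = e"
  using leads_far towards_eq by blast

text \<open>\<open>x\<close> is the neighbour of \<open>u\<close> on the path to \<open>v\<close>.
  If \<open>x\<close> saw \<open>v\<close> back through \<open>u\<close>, then \<open>u\<close> and
  \<open>x\<close> would be joined via \<open>v\<close> without their common edge, which is a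
  bridge.\<close>

lemma next_vertex:
  assumes "u \<in> V" "v \<in> V" "u \<noteq> v"
  defines "x \<equiv> far u (towards T u v)"
  shows "x \<in> V" "x \<noteq> u" "towards T u x = towards T u v" "towards T x u = towards T u v"
    "x \<noteq> v \<Longrightarrow> towards T x v \<noteq> towards T x u"
proof -
  note e = towards_in[OF assms(1-3)]
  have ends: "ends (towards T u v) = {u, x}" unfolding x_def by (rule ends_far[OF e(2)])
  show x: "x \<in> V" "x \<noteq> u" unfolding x_def using far_in far_ne e by auto
  show "towards T u x = towards T u v" unfolding x_def using e by (rule towards_edge)
  show xu: "towards T x u = towards T u v"
    using towards_edge[OF e(1), of x] far_far[OF e] ends by (simp add: x_def)
  assume "x \<noteq> v"
  show "towards T x v \<noteq> towards T x u"
  proof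
    assume "towards T x v = towards T x u"
    then have l: "leads T x (towards T u v) v"
      using leads_towards[OF x(1) assms(2) \<open>x \<noteq> v\<close>] xu by simp
    have "far x (towards T u v) = u" using far_far[OF e] by (simp add: x_def)
    then have "(u, v) \<in> avoiding T x" using l by (auto simp: leads_def)
    moreover have "(x, v) \<in> avoiding T u"
      using leads_towards[OF assms(1-3)] by (auto simp: leads_def x_def)
    ultimately have "(u, x) \<in> (adj (T - {towards T u v}))\<^sup>*"
      using avoiding_remove_edge[of u v T x] avoiding_remove_edge[of v x T u] avoiding_sym ends
      by (metis insertCI rtrancl_trans)
    then show False using bridge[OF e(1) ends] by simp
  qed
qed

lemma towards_ends:
  assumes "e \<in> T"
  shows "towards T (child e) (parent e) = e" "towards T (parent e) (child e) = e"
  using towards_edge[OF assms, of "child e"] towards_edge[OF assms, of "parent e"]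
    no_loop[OF assms] by (auto simp: far_def ends_def)

text \<open>Move along the path from \<open>u\<close> to \<open>v\<close>. The next node looks back
  with the flag opposite to \<open>below T u v\<close>; if it looks ahead with that flag too, it is
  the turn, otherwise it takes over the role of \<open>u\<close>. The measure counts the nodes that
  \<open>u\<close> sees in the direction of \<open>v\<close>.\<close>

lemma turning_vertex:
  assumes "u \<in> V" "v \<in> V" "u \<noteq> v" "below T u v = below T v u"
  shows "\<exists>w\<in>V. w \<noteq> u \<and> w \<noteq> v \<and> towards T w u \<noteq> towards T w v \<and>
    below T w u = (\<not> below T u v) \<and> below T w v = (\<not> below T u v)"
  using assms
proof (induction "card {y \<in> V. y \<noteq> u \<and> towards T u y = towards T u v}" arbitrary: u
    rule: less_induct)
  case less
  note uv = less.prems(1-3)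
  define x where "x = far u (towards T u v)"
  note x = next_vertex[OF uv, folded x_def]
  note e = towards_in[OF uv]
  have xu: "below T x u = (\<not> below T u v)"
    using x(4) no_loop[OF e(1)] e(2) by (auto simp: below_def x_def far_def ends_def)
  \<comment> \<open>An edge has opposite flags at its two ends, whereas the flags at
    \<open>u\<close> and \<open>v\<close> agree.\<close>
  have xv: "x \<noteq> v" using xu less.prems(4) by auto
  note sep = x(5)[OF xv]
  show ?case
  proof (cases "below T x v = below T u v")
    case False
    then show ?thesis using x xv sep xu by auto
  next
    case True
    have "towards T v x = towards T v u"
      using separated_same_direction[of v x u] uv x xv sep by metis
    then have vx: "below T x v = below T v x"
      using True less.prems(4) by (simp add: below_def)
    \<comment> \<open>What \<open>x\<close> sees ahead is also seen ahead by \<open>u\<close>, and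
      \<open>x\<close> itself only by \<open>u\<close>; so the measure drops.\<close>
    have "y \<noteq> u \<and> towards T u y = towards T u v"
      if y: "y \<in> V" "y \<noteq> x" "towards T x y = towards T x v" for y
    proof -
      have ne: "towards T x u \<noteq> towards T x y" using sep y(3) by simp
      then have "y \<noteq> u" by blast
      then show ?thesis
        using separated_same_direction[OF uv(1) x(1) y(1) _ _ ne] x(2,3) y(2) by simp
    qed
    then have "{y \<in> V. y \<noteq> x \<and> towards T x y = towards T x v} \<subseteq>
        {y \<in> V. y \<noteq> u \<and> towards T u y = towards T u v}"
      by blast
    moreover have "x \<in> {y \<in> V. y \<noteq> u \<and> towards T u y = towards T u v}"
      using x(1-3) by simp
    ultimately have "{y \<in> V. y \<noteq> x \<and> towards T x y = towards T x v} \<subset>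
        {y \<in> V. y \<noteq> u \<and> towards T u y = towards T u v}"
      by blast
    then have "card {y \<in> V. y \<noteq> x \<and> towards T x y = towards T x v} <
        card {y \<in> V. y \<noteq> u \<and> towards T u y = towards T u v}"
      using finite_V by (auto intro: psubset_card_mono)
    from less.hyps[OF this x(1) uv(2) xv vx] obtain w where w: "w \<in> V" "w \<noteq> x" "w \<noteq> v"
      "towards T w x \<noteq> towards T w v" "below T w x = (\<not> below T u v)" "below T w v = (\<not> below T u v)"
      using True by auto
    \<comment> \<open>As \<open>w\<close> lies between \<open>x\<close> and \<open>v\<close>, and
      \<open>x\<close> between \<open>u\<close> and \<open>w\<close>, the node \<open>w\<close> sees
      \<open>u\<close> and \<open>x\<close> through the same edge.\<close>
    have xw: "towards T x w = towards T x v"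
      using separated_same_direction[of x w v] w uv x by metis
    then have "w \<noteq> u" using sep by auto
    moreover have "towards T w x = towards T w u"
      using separated_same_direction[of w x u] xw w sep x uv by metis
    ultimately show ?thesis using w by (auto simp: below_def)
  qed
qed

end

section \<open>Slots in a permutree\<close>

text \<open>Here and below, the flag \<open>d\<close> is \<open>True\<close> for child slots and \<open>False\<close> for parent slots, and
  \<open>r\<close> says that the slot is to reach a larger label.\<close>

definition two_slots :: "decoration list \<Rightarrow> nat \<Rightarrow> bool \<Rightarrow> bool" where
  "two_slots \<delta> i d \<longleftrightarrow> (if d then dec \<delta> i \<in> {DecD, DecX} else dec \<delta> i \<in> {DecU, DecX})"

definition slot_at :: "decoration list \<Rightarrow> nat \<Rightarrow> bool \<Rightarrow> bool \<Rightarrow> slot" where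
  "slot_at \<delta> i d r = (if two_slots \<delta> i d then if r then Right else Left else Only)"

text \<open>For \<open>B = below T\<close> this is betweenness of \<open>w\<close> in the tree,
  phrased through \<open>B\<close>, \<open>\<delta>\<close> and the labels alone so that two trees
  can be compared.\<close>

definition separates :: "decoration list \<Rightarrow> (nat \<Rightarrow> nat \<Rightarrow> bool) \<Rightarrow> nat \<Rightarrow> nat \<Rightarrow> nat \<Rightarrow> bool" where
  "separates \<delta> B w u v \<longleftrightarrow>
     B w u \<noteq> B w v \<or> slot_at \<delta> w (B w u) (w < u) \<noteq> slot_at \<delta> w (B w v) (w < v)"

definition port :: "nat \<Rightarrow> edge \<Rightarrow> slot" where
  "port i e = (if parent e = i then cslot e else pslot e)"

locale permutree_locale =
  fixes \<delta> :: "decoration list" and T :: "edge set"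
  assumes permutree: "permutree \<delta> T"
begin

abbreviation "V \<equiv> {1..length \<delta>}"

sublocale labelled_tree V T
  using permutree by unfold_locales (auto simp: permutree_def)

lemma leads_desc_anc:
  assumes "leads T i e j"
  shows "parent e = i \<Longrightarrow> j \<in> desc T i (cslot e)"
    and "parent e \<noteq> i \<Longrightarrow> j \<in> anc T i (pslot e)"
  using assms by (auto simp: leads_def desc_def anc_def component_without_eq far_def ends_def)

text \<open>On a side of \<open>i\<close> with two slots, the label condition leaves only the slot
  matching the position of \<open>j\<close>; on the other sides there is only
  \<open>Only\<close>.\<close>

lemma port_towards:
  assumes "i \<in> V" "j \<in> V" "i \<noteq> j"
  shows "port i (towards T i j) = slot_at \<delta> i (below T i j) (i < j)"
proof -
  let ?e = "towards T i j"
  note l = leads_towards[OF assms] and e = towards_in[OF assms]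
  have slots: "pslot ?e \<in> parent_slots (dec \<delta> (child ?e))"
    "cslot ?e \<in> child_slots (dec \<delta> (parent ?e))"
    using permutree e(1) by (auto simp: permutree_def)
  show ?thesis
  proof (cases "parent ?e = i")
    case True
    then have j: "j \<in> desc T i (cslot ?e)" using leads_desc_anc(1)[OF l] by simp
    have "dec \<delta> i \<in> {DecD, DecX} \<Longrightarrow>
        (\<forall>j\<in>desc T i Left. j < i) \<and> (\<forall>j\<in>desc T i Right. i < j)"
      using permutree assms(1) unfolding permutree_def by blast
    then show ?thesis
      using j slots(2) assms(3) unfolding port_def slot_at_def below_def True child_slots_def two_slots_def
      by (cases "cslot ?e") (auto split: if_splits)
  next
    case False
    then have j: "j \<in> anc T i (pslot ?e)" and "child ?e = i"
      using leads_desc_anc(2)[OF l] e(2) by (auto simp: ends_def)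
    have "dec \<delta> i \<in> {DecU, DecX} \<Longrightarrow>
        (\<forall>j\<in>anc T i Left. j < i) \<and> (\<forall>j\<in>anc T i Right. i < j)"
      using permutree assms(1) unfolding permutree_def by blast
    then show ?thesis
      using j slots(1) assms(3)
      unfolding port_def slot_at_def below_def \<open>child ?e = i\<close> parent_slots_def two_slots_def
      by (cases "pslot ?e") (auto simp: False split: if_splits)
  qed
qed

text \<open>A child slot and a parent slot can bear the same name, so the side has to agree as
  well.\<close>

lemma port_inj:
  assumes "e \<in> T" "e' \<in> T" "i \<in> ends e" "i \<in> ends e'"
    and "(parent e = i) = (parent e' = i)" "port i e = port i e'"
  shows "e = e'"
proof -
  have inj: "child e = child e' \<and> pslot e = pslot e' \<longrightarrow> e = e'"
    "parent e = parent e' \<and> cslot e = cslot e' \<longrightarrow> e = e'"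
    using permutree[unfolded permutree_def, THEN conjunct2, THEN conjunct2, THEN conjunct1]
      permutree[unfolded permutree_def, THEN conjunct2, THEN conjunct2, THEN conjunct2, THEN conjunct1]
      assms(1,2) by simp_all
  show ?thesis
  proof (cases "parent e = i")
    case True
    then have "parent e' = i" using assms(5) by blast
    with True show ?thesis using inj(2) assms(6) unfolding port_def by simp
  next
    case False
    then have "parent e' \<noteq> i" using assms(5) by blast
    with False have "child e = child e'" using assms(3,4) by (simp add: ends_def)
    with False \<open>parent e' \<noteq> i\<close> show ?thesis using inj(1) assms(6) unfolding port_def by simp
  qed
qed

lemma separates_iff:
  assumes "w \<in> V" "u \<in> V" "v \<in> V" "w \<noteq> u" "w \<noteq> v"
  shows "separates \<delta> (below T) w u v \<longleftrightarrow> towards T w u \<noteq> towards T w v"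
proof -
  have "separates \<delta> (below T) w u v \<longleftrightarrow>
      (parent (towards T w u) = w) \<noteq> (parent (towards T w v) = w) \<or>
      port w (towards T w u) \<noteq> port w (towards T w v)"
    unfolding separates_def port_towards[OF assms(1,2,4)] port_towards[OF assms(1,3,5)]
    by (simp add: below_def)
  then show ?thesis
    using port_inj[OF towards_in(1)[OF assms(1,2,4)] towards_in(1)[OF assms(1,3,5)]
        towards_in(2)[OF assms(1,2,4)] towards_in(2)[OF assms(1,3,5)]]
    by metis
qed

text \<open>Two nodes are adjacent exactly when no third node lies between them. All of the
  right-hand side is read off from \<open>below T\<close> and \<open>\<delta>\<close>, so these
  determine the tree.\<close>

lemma edge_iff:
  "Edge c p r q \<in> T \<longleftrightarrow> c \<in> V \<and> r \<in> V \<and> c \<noteq> r \<and> \<not> below T c r \<and> below T r c \<and>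
     p = slot_at \<delta> c False (c < r) \<and> q = slot_at \<delta> r True (r < c) \<and>
     (\<forall>w\<in>V. w \<noteq> c \<longrightarrow> w \<noteq> r \<longrightarrow> \<not> separates \<delta> (below T) w c r)"
  (is "?L \<longleftrightarrow> ?R")
proof
  assume e: ?L
  have V: "c \<in> V" "r \<in> V" using ends_subset[OF e] by (auto simp: ends_def)
  have ne: "c \<noteq> r" using no_loop[OF e] by simp
  have t: "towards T c r = Edge c p r q" "towards T r c = Edge c p r q"
    using towards_ends[OF e] by auto
  then have b: "\<not> below T c r" "below T r c" using ne by (auto simp: below_def)
  moreover have "p = slot_at \<delta> c False (c < r)" "q = slot_at \<delta> r True (r < c)"
    using port_towards[of c r] port_towards[of r c] V ne t b by (auto simp: port_def)
  moreover have "\<not> separates \<delta> (below T) w c r" if w: "w \<in> V" "w \<noteq> c" "w \<noteq> r" for w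
  proof
    assume "separates \<delta> (below T) w c r"
    then have s: "towards T w c \<noteq> towards T w r" using separates_iff w V by blast
    have "(c, r) \<in> avoiding T w"
      unfolding avoiding_def using e w
      by (intro r_into_rtrancl adjI[of "Edge c p r q"]) (auto simp: ends_def)
    then have "leads T w (towards T w c) r"
      using leads_avoiding leads_towards w V by blast
    then show False using towards_eq s by metis
  qed
  ultimately show ?R using V ne by blast
next
  assume R: ?R
  then have V: "c \<in> V" "r \<in> V" "c \<noteq> r" by auto
  let ?e = "towards T c r"
  note x = next_vertex[OF V] and e = towards_in[OF V]
  \<comment> \<open>Otherwise the neighbour of \<open>c\<close> towards \<open>r\<close> would
    separate the two.\<close>
  have far: "far c ?e = r"
  proof (rule ccontr)
    assume ne: "far c ?e \<noteq> r"
    then have "separates \<delta> (below T) (far c ?e) c r"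
      using x separates_iff V by metis
    then show False using R x ne by blast
  qed
  have "parent ?e \<noteq> c" using R by (auto simp: below_def)
  then have ce: "child ?e = c" "parent ?e = r"
    using e(2) far by (auto simp: ends_def far_def)
  have "towards T r c = ?e" using x(4) far by simp
  then have "pslot ?e = p" "cslot ?e = q"
    using port_towards[of c r] port_towards[of r c] V R ce by (auto simp: port_def)
  with ce have "?e = Edge c p r q" by (cases ?e) auto
  then show ?L using e(1) by simp
qed

text \<open>Of three nodes in a tree, at most one lies between the other two.\<close>

lemma separates_unique:
  assumes "a \<in> V" "b \<in> V" "c \<in> V" "a \<noteq> b" "b \<noteq> c" "a \<noteq> c"
    and "separates \<delta> (below T) b a c"
  shows "\<not> separates \<delta> (below T) a b c"
  using separated_same_direction[of a b c] separates_iff assms by metis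

text \<open>The turning node \<open>w\<close> sees \<open>u\<close> and \<open>v\<close> on the same
  side but through different edges. So that side has two slots, and the label condition puts
  \<open>w\<close> between \<open>u\<close> and \<open>v\<close>.\<close>

lemma turning_between:
  assumes "u \<in> V" "v \<in> V" "u < v" "below T u v = d" "below T v u = d"
  shows "\<exists>w. u < w \<and> w < v \<and> two_slots \<delta> w (\<not> d) \<and> below T w u = (\<not> d) \<and> below T w v = (\<not> d)"
proof -
  obtain w where w: "w \<in> V" "w \<noteq> u" "w \<noteq> v" "towards T w u \<noteq> towards T w v"
    "below T w u = (\<not> d)" "below T w v = (\<not> d)"
    using turning_vertex[OF assms(1,2)] assms(3-5) by (metis nat_neq_iff)
  then have "separates \<delta> (below T) w u v" using separates_iff assms by auto
  then have "two_slots \<delta> w (\<not> d)" "w < u \<longleftrightarrow> \<not> w < v"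
    using w(5,6) by (auto simp: separates_def slot_at_def split: if_splits)
  then show ?thesis using w(2,3,5,6) assms(3) by (intro exI[of _ w]) auto
qed

text \<open>The two cases of the cubic set merge: with two child slots, being reached through the
  right one already amounts to having a larger label.\<close>

lemma cubic_set_iff:
  assumes "i \<in> V"
  shows "(i, j) \<in> cubic_set \<delta> T \<longleftrightarrow> j \<in> V \<and> i < j \<and> below T i j"
proof -
  have desc: "j \<in> desc T i s \<longleftrightarrow> (\<exists>e. leads T i e j \<and> parent e = i \<and> cslot e = s)" for s
    by (auto simp: desc_def leads_def component_without_eq far_def ends_def)
  have D: "j \<in> desc T i s \<longleftrightarrow>
      j \<in> V \<and> i \<noteq> j \<and> below T i j \<and> s = slot_at \<delta> i True (i < j)" for s
  proof
    assume "j \<in> desc T i s"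
    then obtain e where e: "leads T i e j" "parent e = i" "cslot e = s" using desc by blast
    then have j: "j \<in> V" "i \<noteq> j" "towards T i j = e"
      using leads_in leads_ne towards_eq by blast+
    then show "j \<in> V \<and> i \<noteq> j \<and> below T i j \<and> s = slot_at \<delta> i True (i < j)"
      using port_towards[OF assms j(1,2)] e(2,3) by (simp add: below_def port_def)
  next
    assume R: "j \<in> V \<and> i \<noteq> j \<and> below T i j \<and> s = slot_at \<delta> i True (i < j)"
    then have j: "j \<in> V" "i \<noteq> j" and p: "parent (towards T i j) = i"
      by (auto simp only: below_def)
    then have "cslot (towards T i j) = s"
      using port_towards[OF assms j] R by (simp add: port_def)
    then show "j \<in> desc T i s" unfolding desc using leads_towards[OF assms j] p by blast
  qed
  show ?thesis
    unfolding cubic_set_def using assms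
    by (cases "dec \<delta> i") (auto simp: D slot_at_def two_slots_def)
qed

end

section \<open>Recovering the relation from the cubic vector\<close>

text \<open>The setting of the induction step at \<open>m\<close>. Both trees keep their nodes below
  \<open>m\<close>, but \<open>turning_between\<close> yields labels between the given two, so the
  arguments stay within \<open>{m..length \<delta>}\<close>.\<close>

locale permutree_pair = P: permutree_locale \<delta> T + P': permutree_locale \<delta> T'
  for \<delta> T T' +
  fixes m
  assumes m: "m \<in> {1..length \<delta>}"
    and agree: "\<And>i j. m < i \<Longrightarrow> m < j \<Longrightarrow> i \<le> length \<delta> \<Longrightarrow> j \<le> length \<delta> \<Longrightarrow> i \<noteq> j \<Longrightarrow>
      below T i j = below T' i j"
begin

abbreviation "B \<equiv> below T"
abbreviation "B' \<equiv> below T'"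

lemma not_incomparable:
  assumes "m < a" "a \<le> length \<delta>" "B m a" "\<not> B' m a"
    and "m < b" "b \<le> length \<delta>" "\<not> B m b" "B' m b"
  shows False
  using assms(1-4)
proof (induction a rule: less_induct)
  case (less a)
  have ab: "a \<noteq> b" using less assms by auto
  have mV: "m \<ge> 1" using m by simp
  \<comment> \<open>In both trees \<open>m\<close> lies between \<open>a\<close> and
    \<open>b\<close>, so \<open>a\<close> sees \<open>m\<close> with the same flag as
    \<open>b\<close>, and for \<open>b\<close> the trees agree.\<close>
  have sa: "\<not> separates \<delta> B a m b" 
    using P.separates_unique[of a m b] less.prems assms ab mV by (auto simp: separates_def)
  have sa': "\<not> separates \<delta> B' a m b"
    using P'.separates_unique[of a m b] less.prems assms ab mV by (auto simp: separates_def)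
  have am: "B a m = B' a m"
    using sa sa' agree[of a b] less.prems assms ab by (auto simp: separates_def)
  show False
  \<comment> \<open>Either both flags between \<open>m\<close> and \<open>a\<close> are
    \<open>True\<close> in \<open>T\<close>, or both are \<open>False\<close> in \<open>T'\<close>;
    that tree supplies the turning node.\<close>
  proof (cases "B a m")
    case True
    obtain w where w: "m < w" "w < a" "two_slots \<delta> w False" "\<not> B w m" "\<not> B w a"
      using P.turning_between[of m a True] True less.prems m by auto
    have wV: "w \<le> length \<delta>" using w less.prems by simp
    have "separates \<delta> B w m a" using w by (auto simp: separates_def slot_at_def)
    then have mw: "B m w"
      using P.separates_unique[of m w a] w wV less.prems mV by (auto simp: separates_def)
    \<comment> \<open>In \<open>T'\<close> too, \<open>w\<close> lies between \<open>m\<close> and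
      \<open>a\<close>: if \<open>B' w m\<close> fails like \<open>B' w a\<close>, then
      \<open>m\<close> and \<open>a\<close> use different parent slots of \<open>w\<close>. Hence
      \<open>m\<close> sees \<open>w\<close> and \<open>a\<close> with one flag.\<close>
    have "\<not> separates \<delta> B' m w a \<or> \<not> separates \<delta> B' w m a"
      using P'.separates_unique[of w m a] w wV less.prems mV by auto
    moreover have "\<not> B' w a" using agree[of w a] w wV less.prems by auto
    ultimately have "\<not> B' m w"
      using w less.prems by (auto simp: separates_def slot_at_def split: if_splits)
    then show False using less.IH[of w] w wV mw by blast
  next
    case False
    obtain w where w: "m < w" "w < a" "two_slots \<delta> w True" "B' w m" "B' w a"
      using P'.turning_between[of m a False] False am less.prems m by auto
    have wV: "w \<le> length \<delta>" using w less.prems by simp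
    have "separates \<delta> B' w m a" using w by (auto simp: separates_def slot_at_def)
    then have mw: "\<not> B' m w"
      using P'.separates_unique[of m w a] w wV less.prems mV by (auto simp: separates_def)
    have "\<not> separates \<delta> B m w a \<or> \<not> separates \<delta> B w m a"
      using P.separates_unique[of w m a] w wV less.prems mV by auto
    moreover have "B w a" using agree[of w a] w wV less.prems by auto
    ultimately have "B m w"
      using w less.prems by (auto simp: separates_def slot_at_def split: if_splits)
    then show False using less.IH[of w] w wV mw by blast
  qed
qed

text \<open>The turning node \<open>w\<close> of \<open>T\<close> would be between \<open>m\<close>
  and \<open>j\<close> in \<open>T'\<close> because of its flag towards \<open>j\<close> and its two
  slots, while the flags at \<open>j\<close> would put \<open>j\<close> between \<open>w\<close> and
  \<open>m\<close>.\<close>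

lemma reverse_direction_transfer:
  assumes "m < j" "j \<le> length \<delta>" "B j m = B m j"
  shows "B' j m = B m j"
proof (rule ccontr)
  assume ne: "B' j m \<noteq> B m j"
  obtain w where w: "m < w" "w < j" "two_slots \<delta> w (\<not> B m j)" "B w m = (\<not> B m j)" "B w j = (\<not> B m j)"
    using P.turning_between[of m j "B m j"] assms m by auto
  have V: "w \<in> {1..length \<delta>}" "j \<in> {1..length \<delta>}" using w assms by auto
  have "separates \<delta> B w j m" using w by (auto simp: separates_def slot_at_def)
  then have "\<not> separates \<delta> B j w m" using P.separates_unique[of j w m] w V m by auto
  then have "B' j w = B m j"
    using agree[of j w] w V assms by (auto simp: separates_def)
  then have "separates \<delta> B' j w m" using ne by (auto simp: separates_def)
  then have "\<not> separates \<delta> B' w j m" using P'.separates_unique[of w j m] w V m by auto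
  moreover have "B' w j = (\<not> B m j)" using agree[of w j] w V by auto
  ultimately show False
    using w by (auto simp: separates_def slot_at_def split: if_splits)
qed

end

lemma (in permutree_pair) flipped: "permutree_pair \<delta> T' T m"
  using m agree by unfold_locales auto

lemma (in permutree_pair) agree_step:
  assumes card: "card {j \<in> {m<..length \<delta>}. B m j} = card {j \<in> {m<..length \<delta>}. B' m j}"
    and "m \<le> i" "m \<le> j" "i \<le> length \<delta>" "j \<le> length \<delta>" "i \<noteq> j"
  shows "B i j = B' i j"
proof -
  let ?S = "{j \<in> {m<..length \<delta>}. B m j}" and ?S' = "{j \<in> {m<..length \<delta>}. B' m j}"
  have "?S \<subseteq> ?S' \<or> ?S' \<subseteq> ?S"
    using not_incomparable by fastforce
  then have S: "?S = ?S'"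
    using card card_subset_eq[of ?S' ?S] card_subset_eq[of ?S ?S'] by auto
  have up: "B m k = B' m k" if "m < k" "k \<le> length \<delta>" for k
  proof -
    have "k \<in> ?S \<longleftrightarrow> k \<in> ?S'" using S by simp
    then show ?thesis using that by simp
  qed
  \<comment> \<open>If the flags between \<open>k\<close> and \<open>m\<close> coincide in one of
    the trees, the transfer lemma applies; otherwise both trees have opposite flags there and
    \<open>up\<close> decides.\<close>
  have down: "B k m = B' k m" if "m < k" "k \<le> length \<delta>" for k
    using reverse_direction_transfer[OF that] permutree_pair.reverse_direction_transfer[OF flipped that] up[OF that]
    by blast
  show ?thesis
    using agree[of i j] up[of j] down[of i] assms(2-) by (cases "m = i"; cases "m = j") auto
qed

section \<open>Downward induction and injectivity\<close>

lemma card_cubic_set: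
  assumes "permutree \<delta> T" "m \<in> {1..length \<delta>}"
  shows "card {j. (m, j) \<in> cubic_set \<delta> T} = card {j \<in> {m<..length \<delta>}. below T m j}"
proof -
  interpret permutree_locale \<delta> T by unfold_locales fact
  show ?thesis
    using assms(2) by (intro arg_cong[of _ _ card]) (auto simp: cubic_set_iff)
qed

lemma cubic_vector_determines_below:
  assumes "permutree \<delta> T" "permutree \<delta> T'" "cubic_vector \<delta> T = cubic_vector \<delta> T'"
    and "i \<in> {1..length \<delta>}" "j \<in> {1..length \<delta>}" "i \<noteq> j"
  shows "below T i j = below T' i j"
proof -
  have card: "card {j \<in> {m<..length \<delta>}. below T m j} = card {j \<in> {m<..length \<delta>}. below T' m j}"
    if "m \<in> {1..length \<delta>}" for m
  \<comment> \<open>The vector has no entry for the last label, but there both sets are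
    empty.\<close>
  proof (cases "m = length \<delta>")
    case False
    then have "m \<in> set [1..<length \<delta>]" using that by auto
    then have "card {j. (m, j) \<in> cubic_set \<delta> T} = card {j. (m, j) \<in> cubic_set \<delta> T'}"
      using assms(3) unfolding cubic_vector_def map_eq_conv by simp
    then show ?thesis using card_cubic_set assms(1,2) that by simp
  qed simp
  \<comment> \<open>The induction starts vacuously at \<open>Suc (length \<delta>)\<close> and
    descends to 1.\<close>
  have "\<forall>i j. m \<le> i \<longrightarrow> m \<le> j \<longrightarrow> i \<le> length \<delta> \<longrightarrow> j \<le> length \<delta> \<longrightarrow> i \<noteq> j \<longrightarrow>
      below T i j = below T' i j" if "1 \<le> m" "m \<le> Suc (length \<delta>)" for m
    using that(2,1)
  proof (induction m rule: inc_induct)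
    case (step k)
    interpret permutree_pair \<delta> T T' k
      using assms(1,2) step by unfold_locales auto
    show ?case using agree_step[OF card] step.prems step.hyps by auto
  qed simp
  from this[of 1] show ?thesis using assms(4-) by simp
qed

theorem theorem3p18:
  fixes \<delta> :: "decoration list" and n :: nat
  assumes "n \<ge> 1" and "length \<delta> = n"
  shows "inj_on (cubic_vector \<delta>) {T. permutree \<delta> T}"
proof (rule inj_onI)
  fix T T' assume "T \<in> {T. permutree \<delta> T}" "T' \<in> {T. permutree \<delta> T}"
    and eq: "cubic_vector \<delta> T = cubic_vector \<delta> T'"
  then have T: "permutree \<delta> T" and T': "permutree \<delta> T'" by auto
  interpret P: permutree_locale \<delta> T by unfold_locales fact
  interpret P': permutree_locale \<delta> T' by unfold_locales fact
  note B = cubic_vector_determines_below[OF T T' eq]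
  \<comment> \<open>Separation by \<open>w\<close> involves only flags at \<open>w\<close>, so it
    agrees as well, and \<open>edge_iff\<close> then gives the same edges.\<close>
  have sep: "separates \<delta> (below T) w c r = separates \<delta> (below T') w c r"
    if "w \<in> {1..length \<delta>}" "c \<in> {1..length \<delta>}" "r \<in> {1..length \<delta>}" "w \<noteq> c" "w \<noteq> r" for w c r
    using B[of w c] B[of w r] that by (simp add: separates_def)
  have "Edge c p r q \<in> T \<longleftrightarrow> Edge c p r q \<in> T'" for c p r q
    unfolding P.edge_iff P'.edge_iff using B sep by metis
  then show "T = T'"
    by (metis edge.exhaust subsetI subset_antisym)
qed

end
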